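(* Any algorithm that computes the minimum spanning tree, with probability greater than $1/2$, for every set of $n>6$ points whose metric has doubling dimension at most $\log 3$, accessible only through a distance oracle, requires (on some such input) at least $n^2/16$ distance queries and at least $n^2/(16ms^2)$ rounds.
   Context: Black-box distance oracle model: there are $m$ machines; each machine can store at most $s\ge2$ point identifiers at a time, and in a round can query the distance oracle, in parallel, on pairs of identifiers it holds; hence at most $m\binom{s}{2}\le ms^2$ distance queries are made per round. The doubling dimension of a metric space is the smallest $d$ such that every ball of radius $r$ can be covered by at most $2^d$ balls of radius $r/2$. *)

theory Defs
  imports "HOL-Probability.Probability"
begin

section \<open>Doubling dimension\<close>

text \<open>
  Balls are closed and are centred at points of the space.  The value is \<open>\<infinity>\<close> if no
  real \<open>k\<close> qualifies; on a finite non-empty space the infimum is attained.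
\<close>

definition doubling_with :: "'a set \<Rightarrow> ('a \<Rightarrow> 'a \<Rightarrow> real) \<Rightarrow> real \<Rightarrow> bool" where
  "doubling_with X d k \<longleftrightarrow>
     (\<forall>x\<in>X. \<forall>r>0. \<exists>C\<subseteq>X. finite C \<and> real (card C) \<le> 2 powr k \<and>
        Metric_space.mcball X d x r \<subseteq> (\<Union>c\<in>C. Metric_space.mcball X d c (r / 2)))"

definition doubling_dimension :: "'a set \<Rightarrow> ('a \<Rightarrow> 'a \<Rightarrow> real) \<Rightarrow> ereal" where
  "doubling_dimension X d = (INF k\<in>{k. doubling_with X d k}. ereal k)"

section \<open>Minimum spanning trees\<close>

text \<open>
  An unordered pair of distinct points is encoded as the increasing pair \<open>(u, v)\<close>, \<open>u < v\<close>.
  Both tree edges and distance queries use this encoding.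
\<close>

definition pairs :: "nat set \<Rightarrow> (nat \<times> nat) set" where
  "pairs X = {(u, v). u \<in> X \<and> v \<in> X \<and> u < v}"

definition connects :: "nat set \<Rightarrow> (nat \<times> nat) set \<Rightarrow> bool" where
  "connects X T \<longleftrightarrow> (\<forall>u\<in>X. \<forall>v\<in>X. (u, v) \<in> (T \<union> T\<inverse>)\<^sup>*)"

definition is_cycle :: "(nat \<times> nat) set \<Rightarrow> nat list \<Rightarrow> bool" where
  "is_cycle T vs \<longleftrightarrow> 3 \<le> length vs \<and> distinct vs \<and>
     (\<forall>i<length vs. (vs ! i, vs ! (Suc i mod length vs)) \<in> T \<union> T\<inverse>)"

definition spanning_tree :: "nat set \<Rightarrow> (nat \<times> nat) set \<Rightarrow> bool" where
  "spanning_tree X T \<longleftrightarrow> T \<subseteq> pairs X \<and> connects X T \<and> (\<nexists>vs. is_cycle T vs)"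

definition weight :: "(nat \<Rightarrow> nat \<Rightarrow> real) \<Rightarrow> (nat \<times> nat) set \<Rightarrow> real" where
  "weight d T = (\<Sum>(u, v)\<in>T. d u v)"

definition minimum_spanning_tree ::
    "nat set \<Rightarrow> (nat \<Rightarrow> nat \<Rightarrow> real) \<Rightarrow> (nat \<times> nat) set \<Rightarrow> bool" where
  "minimum_spanning_tree X d T \<longleftrightarrow>
     spanning_tree X T \<and> (\<forall>T'. spanning_tree X T' \<longrightarrow> weight d T \<le> weight d T')"

section \<open>The black-box distance oracle model\<close>

text \<open>
  The points have identifiers \<open>0, \<dots>, n - 1\<close>, the machines are \<open>0, \<dots>, m - 1\<close>, and \<open>'c\<close> is
  the type of local machine states.  In a round every machine queries pairs of
  identifiers it holds; then each machine computes its next state from the states of all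
  machines and the answers they received (communication, local computation and memory other
  than for identifiers are not restricted).  The algorithm stops at the
  first configuration on which \<open>result\<close> is not \<open>None\<close>; it need not stop.
\<close>

record 'c program =
  initial :: "nat \<Rightarrow> 'c"
  held :: "'c \<Rightarrow> nat set"
  queries :: "'c \<Rightarrow> (nat \<times> nat) set"
  step :: "nat \<Rightarrow> (nat \<Rightarrow> 'c \<times> (nat \<times> nat \<Rightarrow> real option)) \<Rightarrow> 'c"
  result :: "(nat \<Rightarrow> 'c) \<Rightarrow> (nat \<times> nat) set option"

definition black_box_program :: "nat \<Rightarrow> nat \<Rightarrow> 'c program \<Rightarrow> bool" where
  "black_box_program n s P \<longleftrightarrow>
     (\<forall>c. held P c \<subseteq> {..<n} \<and> card (held P c) \<le> s \<and> queries P c \<subseteq> pairs (held P c))"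

text \<open>
  The metric is accessed only here.  Configurations are total functions on \<open>nat\<close>; the
  entries with index at least \<open>m\<close> are not machines and receive no answers.
\<close>

definition answers ::
    "'c program \<Rightarrow> nat \<Rightarrow> (nat \<Rightarrow> nat \<Rightarrow> real) \<Rightarrow> (nat \<Rightarrow> 'c) \<Rightarrow> nat \<Rightarrow> nat \<times> nat \<Rightarrow> real option"
  where
  "answers P m d \<sigma> i =
     (\<lambda>(u, v). if i < m \<and> (u, v) \<in> queries P (\<sigma> i) then Some (d u v) else None)"

primrec config :: "'c program \<Rightarrow> nat \<Rightarrow> (nat \<Rightarrow> nat \<Rightarrow> real) \<Rightarrow> nat \<Rightarrow> nat \<Rightarrow> 'c" where
  "config P m d 0 = initial P"
| "config P m d (Suc t) =
     (\<lambda>i. step P i (\<lambda>j. (config P m d t j, answers P m d (config P m d t) j)))"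

definition halted :: "'c program \<Rightarrow> nat \<Rightarrow> (nat \<Rightarrow> nat \<Rightarrow> real) \<Rightarrow> nat \<Rightarrow> bool" where
  "halted P m d t \<longleftrightarrow> (\<exists>t'\<le>t. result P (config P m d t') \<noteq> None)"

definition outcome ::
    "'c program \<Rightarrow> nat \<Rightarrow> (nat \<Rightarrow> nat \<Rightarrow> real) \<Rightarrow> (nat \<times> nat) set option" where
  "outcome P m d =
     (if \<exists>t. halted P m d t then result P (config P m d (LEAST t. halted P m d t)) else None)"

text \<open>
  Round \<open>t\<close> (counted from 0) takes place iff the program has not halted at configuration \<open>t\<close>.
\<close>

definition num_rounds :: "'c program \<Rightarrow> nat \<Rightarrow> (nat \<Rightarrow> nat \<Rightarrow> real) \<Rightarrow> ennreal" where
  "num_rounds P m d = (\<Sum>t. if halted P m d t then 0 else 1)"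

definition num_queries :: "'c program \<Rightarrow> nat \<Rightarrow> (nat \<Rightarrow> nat \<Rightarrow> real) \<Rightarrow> ennreal" where
  "num_queries P m d =
     (\<Sum>t. if halted P m d t then 0
           else of_nat (\<Sum>i<m. card (queries P (config P m d t i))))"

definition low_doubling_input :: "nat \<Rightarrow> (nat \<Rightarrow> nat \<Rightarrow> real) \<Rightarrow> bool" where
  "low_doubling_input n d \<longleftrightarrow>
     Metric_space {..<n} d \<and> doubling_dimension {..<n} d \<le> ereal (log 2 3)"

text \<open>
  A randomized algorithm is a family \<open>A\<close> of programs indexed by the outcomes of a
  probability space \<open>M\<close>.  If the success event is not measurable, its \<open>measure\<close> is 0, so
  a success probability greater than \<open>1/2\<close> includes measurability.
\<close>

definition success_probability ::
    "'w measure \<Rightarrow> ('w \<Rightarrow> 'c program) \<Rightarrow> nat \<Rightarrow> nat \<Rightarrow> (nat \<Rightarrow> nat \<Rightarrow> real) \<Rightarrow> real" where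
  "success_probability M A n m d =
     measure M {\<omega> \<in> space M. \<exists>T. outcome (A \<omega>) m d = Some T \<and>
                                 minimum_spanning_tree {..<n} d T}"

text \<open>
  Nothing is assumed about measurability of the costs: for a non-measurable function
  \<open>nn_integral\<close> is the lower integral, so a lower bound on it is only harder to meet.
\<close>

definition expected_queries ::
    "'w measure \<Rightarrow> ('w \<Rightarrow> 'c program) \<Rightarrow> nat \<Rightarrow> (nat \<Rightarrow> nat \<Rightarrow> real) \<Rightarrow> ennreal" where
  "expected_queries M A m d = (\<integral>\<^sup>+\<omega>. num_queries (A \<omega>) m d \<partial>M)"

definition expected_rounds ::
    "'w measure \<Rightarrow> ('w \<Rightarrow> 'c program) \<Rightarrow> nat \<Rightarrow> (nat \<Rightarrow> nat \<Rightarrow> real) \<Rightarrow> ennreal" where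
  "expected_rounds M A m d = (\<integral>\<^sup>+\<omega>. num_rounds (A \<omega>) m d \<partial>M)"

end

theory Submission
  imports Defs
begin

text \<open>
  Split the points into two paths with unit steps, all distances between different paths
  being \<open>4 * n\<close>.  Shortening a single such distance by 1 yields again a metric of doubling
  dimension at most \<open>log 2 3\<close>, and forces the shortened pair to be the only edge of a
  minimum spanning tree that joins the two paths.  A run on the unperturbed metric that does
  not query a pair \<open>p\<close> is also the run on the metric shortened at \<open>p\<close>.  Hence, for every
  outcome of the coin tosses, the number of pairs \<open>p\<close> for which the algorithm is correct
  exceeds the number of queries on the unperturbed metric by at most 1.  Integrating, the
  roughly \<open>n\<^sup>2 / 4\<close> pairs force more than \<open>n\<^sup>2 / 8 - 9 / 8\<close> expected queries.
\<close>

section \<open>Graphs\<close>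

text \<open>On a cycle, a vertex of maximal rank has two different neighbours, neither of larger
  rank; the hypothesis forbids exactly this.\<close>

lemma no_cycle_if_unique_lower_neighbour:
  fixes rank :: "nat \<Rightarrow> nat"
  assumes "\<And>x y z. (y, x) \<in> T \<union> T\<inverse> \<Longrightarrow> (x, z) \<in> T \<union> T\<inverse> \<Longrightarrow>
             rank y \<le> rank x \<Longrightarrow> rank z \<le> rank x \<Longrightarrow> y = z"
  shows "\<not> is_cycle T vs"
proof
  assume c: "is_cycle T vs"
  define l where "l = length vs"
  have l: "3 \<le> l" "distinct vs"
    and adj: "\<And>i. i < l \<Longrightarrow> (vs ! i, vs ! (Suc i mod l)) \<in> T \<union> T\<inverse>"
    using c unfolding is_cycle_def l_def by auto
  obtain x where x: "x \<in> set vs" "\<And>y. y \<in> set vs \<Longrightarrow> rank y \<le> rank x"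
  proof -
    have ne: "rank ` set vs \<noteq> {}" using l l_def by auto
    then have "Max (rank ` set vs) \<in> rank ` set vs" by (intro Max_in) auto
    then obtain x where "x \<in> set vs" "rank x = Max (rank ` set vs)" by auto
    then show ?thesis using that by (metis Max_ge List.finite_set finite_imageI imageI)
  qed
  obtain i where i: "i < l" "x = vs ! i"
    using x(1) by (metis in_set_conv_nth l_def)
  \<comment> \<open>\<open>j\<close> and \<open>k\<close> are the cyclic predecessor and successor
    of \<open>i\<close>; they differ because a cycle has at least three vertices.\<close>
  define j where "j = (if i = 0 then l - 1 else i - 1)"
  have j: "j < l" "Suc j mod l = i" using i l by (auto simp: j_def)
  define k where "k = Suc i mod l"
  have k: "k < l" using l by (simp add: k_def)
  have "j \<noteq> k"
  proof (cases "Suc i = l")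
    case True
    then show ?thesis using l by (auto simp: j_def k_def)
  next
    case False
    then have "k = Suc i" using i by (simp add: k_def)
    then show ?thesis using l by (auto simp: j_def split: if_splits)
  qed
  moreover have "vs ! j = vs ! k"
  proof (rule assms)
    show "(vs ! j, x) \<in> T \<union> T\<inverse>" using adj[OF j(1)] j(2) i(2) by simp
    show "(x, vs ! k) \<in> T \<union> T\<inverse>" using adj[OF i(1)] i(2) k_def by simp
    show "rank (vs ! j) \<le> rank x" "rank (vs ! k) \<le> rank x"
      using x(2) j(1) k l_def by auto
  qed
  ultimately show False using l(2) j(1) k l_def nth_eq_iff_index_eq by blast
qed

text \<open>Send each vertex other than \<open>r\<close> to the last edge of a shortest walk from
  \<open>r\<close>. The other end of that edge is strictly closer to \<open>r\<close>, so the edge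
  determines the vertex and the map is injective.\<close>

lemma card_edges_if_connects:
  assumes "finite X" "r \<in> X" "T \<subseteq> pairs X" "connects X T"
  shows "card X \<le> Suc (card T)"
proof -
  define E where "E = T \<union> T\<inverse>"
  define dst where "dst v = (LEAST k. (r, v) \<in> E ^^ k)" for v
  have "finite T"
    by (rule finite_subset[of _ "X \<times> X"]) (use assms in \<open>auto simp: pairs_def\<close>)
  have "\<exists>e\<in>T. \<exists>w. (e = (v, w) \<or> e = (w, v)) \<and> dst w < dst v" if v: "v \<in> X - {r}" for v
  proof -
    have "(r, v) \<in> E\<^sup>*" using assms v unfolding connects_def E_def by blast
    then obtain k where "(r, v) \<in> E ^^ k" using rtrancl_imp_relpow by blast
    then have k: "(r, v) \<in> E ^^ dst v" unfolding dst_def by (rule LeastI)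
    moreover have "dst v \<noteq> 0"
    proof
      assume "dst v = 0"
      then show False using k v by simp
    qed
    ultimately obtain j where j: "dst v = Suc j" "(r, v) \<in> E ^^ Suc j"
      by (metis not0_implies_Suc)
    then obtain w where w: "(r, w) \<in> E ^^ j" "(w, v) \<in> E" by auto
    have "dst w \<le> j" unfolding dst_def using w(1) by (rule Least_le)
    then have "dst w < dst v" using j(1) by simp
    moreover have "(w, v) \<in> T \<or> (v, w) \<in> T" using w(2) by (simp add: E_def)
    ultimately show ?thesis by blast
  qed
  then have "\<forall>v\<in>X - {r}. \<exists>e. e \<in> T \<and> (\<exists>w. (e = (v, w) \<or> e = (w, v)) \<and> dst w < dst v)"
    by blast
  from bchoice[OF this] obtain e where e: "\<And>v. v \<in> X - {r} \<Longrightarrow>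
      e v \<in> T \<and> (\<exists>w. (e v = (v, w) \<or> e v = (w, v)) \<and> dst w < dst v)"
    by blast
  have "inj_on e (X - {r})"
  proof
    fix v v' assume v: "v \<in> X - {r}" "v' \<in> X - {r}" "e v = e v'"
    show "v = v'"
      using e[OF v(1)] e[OF v(2)] v(3) by auto
  qed
  moreover have "e ` (X - {r}) \<subseteq> T" using e by blast
  ultimately have "card (X - {r}) \<le> card T" using \<open>finite T\<close> by (rule card_inj_on_le)
  then show ?thesis using assms(1,2) by simp
qed

text \<open>Otherwise \<open>P\<close> would be constant along every walk from \<open>x\<close> to
  \<open>y\<close>.\<close>

lemma connects_crosses_cut:
  assumes "connects X T" "x \<in> X" "y \<in> X" "P x" "\<not> P y"
  shows "\<exists>(u, v)\<in>T. P u \<noteq> P v"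
proof (rule ccontr)
  assume "\<not> ?thesis"
  then have same: "(u, v) \<in> T \<union> T\<inverse> \<Longrightarrow> P u = P v" for u v by auto
  have "(x, y) \<in> (T \<union> T\<inverse>)\<^sup>*" using assms unfolding connects_def by blast
  then have "P x = P y"
  proof (induction rule: rtrancl_induct)
    case (step y z)
    then show ?case using same by blast
  qed simp
  then show False using assms by simp
qed

section \<open>Two paths at a large distance\<close>

text \<open>\<open>H\<close> holds the shortened pairs: \<open>{}\<close> gives the unperturbed
  metric, \<open>{p}\<close> the one shortened at \<open>p\<close>. Testing both orders keeps the
  distance symmetric.\<close>

definition two_paths :: "nat \<Rightarrow> (nat \<times> nat) set \<Rightarrow> nat \<Rightarrow> nat \<Rightarrow> real" where
  "two_paths n H u v =
     (if (u < n div 2) = (v < n div 2) then \<bar>real u - real v\<bar>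
      else if (u, v) \<in> H \<or> (v, u) \<in> H then 4 * real n - 1 else 4 * real n)"

text \<open>The first component is always the smaller one, so these pairs are already in the
  increasing encoding of edges and queries.\<close>

definition crossing_pairs :: "nat \<Rightarrow> (nat \<times> nat) set" where
  "crossing_pairs n = {..<n div 2} \<times> {n div 2..<n}"

text \<open>The triangle inequality is the real point. Distances between the paths differ by at most
  1 and distinct points are at least 1 apart, so a detour does not undercut a long distance; two
  long legs exceed every distance within a path.\<close>

lemma Metric_space_two_paths:
  assumes "1 \<le> n"
  shows "Metric_space {..<n} (two_paths n H)"
proof
  show "0 \<le> two_paths n H x y" for x y
    using assms by (auto simp: two_paths_def)
  show "two_paths n H x y = two_paths n H y x" for x y
    by (auto simp: two_paths_def)
  show "two_paths n H x y = 0 \<longleftrightarrow> x = y" if "x \<in> {..<n}" "y \<in> {..<n}" for x y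
    using assms by (auto simp: two_paths_def)
  show "two_paths n H x z \<le> two_paths n H x y + two_paths n H y z"
    if "x \<in> {..<n}" "y \<in> {..<n}" "z \<in> {..<n}" for x y z
  proof -
    have near: "two_paths n H u v = \<bar>real u - real v\<bar>" if "(u < n div 2) = (v < n div 2)" for u v
      using that by (simp add: two_paths_def)
    have far: "4 * real n - 1 \<le> two_paths n H u v" "two_paths n H u v \<le> 4 * real n"
      if "(u < n div 2) \<noteq> (v < n div 2)" for u v
      using that by (auto simp: two_paths_def)
    have small: "\<bar>real u - real v\<bar> < real n" if "u < n" "v < n" for u v
      using that by linarith
    have apart: "1 \<le> \<bar>real u - real v\<bar>" if "u \<noteq> v" for u v :: nat
      using that by linarith
    have b: "x < n" "y < n" "z < n" using that by auto
    consider "x = y" | "y = z" | "x \<noteq> y" "y \<noteq> z" by blast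
    then show ?thesis
    proof cases
      case 1
      then show ?thesis by (simp add: near)
    next
      case 2
      then show ?thesis by (simp add: near)
    next
      case 3
      note ap = apart[OF 3(1)] apart[OF 3(2)]
      note sm = small[OF b(1,3)]
      show ?thesis
      proof (cases "(x < n div 2) = (y < n div 2)")
        case xy: True
        show ?thesis
        proof (cases "(y < n div 2) = (z < n div 2)")
          case True
          then show ?thesis using xy near[of x y] near[of y z] near[of x z] by simp
        next
          case False
          then show ?thesis using xy near[of x y] far[of y z] far[of x z] ap by simp
        qed
      next
        case xy: False
        show ?thesis
        proof (cases "(y < n div 2) = (z < n div 2)")
          case True
          then show ?thesis using xy far[of x y] near[of y z] far[of x z] ap by simp
        next
          case False
          then have "(x < n div 2) = (z < n div 2)" using xy by blast
          then show ?thesis using xy False far[of x y] far[of y z] near[of x z] sm assms by simp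
        qed
      qed
    qed
  qed
qed

text \<open>A ball that reaches the other path has radius at least \<open>4 * n - 1\<close>, so half
  its radius exceeds the diameter of either path and one centre in each path suffices. A smaller
  ball is an interval of one path, covered from its two ends and its centre.\<close>

lemma doubling_with_two_paths:
  assumes "2 \<le> n"
  shows "doubling_with {..<n} (two_paths n H) (log 2 3)"
proof -
  interpret Metric_space "{..<n}" "two_paths n H"
    using assms by (intro Metric_space_two_paths) simp
  have "\<exists>C\<subseteq>{..<n}. finite C \<and> card C \<le> 3 \<and> mcball x r \<subseteq> (\<Union>c\<in>C. mcball c (r / 2))"
    if x: "x < n" and r: "r > 0" for x r
  proof (cases "r \<ge> 4 * real n - 1")
    case True
    have "mcball x r \<subseteq> (\<Union>c\<in>{0, n - 1}. mcball c (r / 2))"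
    proof
      fix y assume "y \<in> mcball x r"
      then have y: "y < n" by simp
      have h: "0 < n div 2" "\<not> n - 1 < n div 2" using assms by auto
      have r2: "real n \<le> r / 2" using True assms by simp
      show "y \<in> (\<Union>c\<in>{0, n - 1}. mcball c (r / 2))"
      proof (cases "y < n div 2")
        case True
        then have "two_paths n H 0 y \<le> r / 2" using h y r2 by (simp add: two_paths_def)
        then show ?thesis using y assms by auto
      next
        case False
        then have "two_paths n H (n - 1) y \<le> r / 2" using h y r2 by (simp add: two_paths_def)
        then show ?thesis using y assms by auto
      qed
    qed
    then show ?thesis
      using assms by (intro exI[of _ "{0, n - 1}"]) (auto simp: card_insert_if)
  next
    case False
    define B where "B = mcball x r"
    have B: "y < n \<and> (x < n div 2) = (y < n div 2) \<and> \<bar>real x - real y\<bar> \<le> r" if "y \<in> B" for y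
      using that False by (auto simp: B_def two_paths_def split: if_splits)
    have fB: "finite B" by (rule finite_subset[of _ "{..<n}"]) (use B in auto)
    have xB: "x \<in> B" using x r by (simp add: B_def two_paths_def)
    define lo hi where "lo = Min B" and "hi = Max B"
    have "B \<noteq> {}" using xB by blast
    then have "lo \<in> B" "hi \<in> B" using fB by (simp_all add: lo_def hi_def)
    have bounds: "lo \<le> y" "y \<le> hi" if "y \<in> B" for y using that fB by (auto simp: lo_def hi_def)
    have "y \<in> (\<Union>c\<in>{lo, x, hi}. mcball c (r / 2))" if y: "y \<in> B" for y
    proof -
      \<comment> \<open>\<open>y\<close> lies between \<open>x\<close> and one of \<open>lo\<close>,
        \<open>hi\<close>, which are within \<open>r\<close> of \<open>x\<close>; the nearer of
        these two points is within \<open>r / 2\<close> of \<open>y\<close>.\<close>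
      have "\<exists>c\<in>{lo, x, hi}. \<bar>real c - real y\<bar> \<le> r / 2"
        using bounds[OF y] B[OF \<open>lo \<in> B\<close>] B[OF \<open>hi \<in> B\<close>] B[OF y] by (auto simp: abs_if)
      then obtain c where c: "c \<in> {lo, x, hi}" "\<bar>real c - real y\<bar> \<le> r / 2" by blast
      then have "c \<in> B" using \<open>lo \<in> B\<close> \<open>hi \<in> B\<close> xB by auto
      then have "y \<in> mcball c (r / 2)"
        using B[of c] B[OF y] c(2) by (auto simp: two_paths_def)
      then show ?thesis using c(1) by blast
    qed
    moreover have "{lo, x, hi} \<subseteq> {..<n}" using B \<open>lo \<in> B\<close> \<open>hi \<in> B\<close> xB by auto
    ultimately have "{lo, x, hi} \<subseteq> {..<n} \<and> mcball x r \<subseteq> (\<Union>c\<in>{lo, x, hi}. mcball c (r / 2))"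
      unfolding B_def by blast
    then show ?thesis
      by (intro exI[of _ "{lo, x, hi}"]) (simp add: card_insert_if)
  qed
  then show ?thesis unfolding doubling_with_def by fastforce
qed

lemma low_doubling_input_two_paths:
  assumes "2 \<le> n"
  shows "low_doubling_input n (two_paths n H)"
  unfolding low_doubling_input_def doubling_dimension_def
  using assms Metric_space_two_paths doubling_with_two_paths by (auto intro!: INF_lower)

text \<open>The excluded index \<open>n div 2 - 1\<close> is the step from the end of the first path
  to the start of the second; the bridge \<open>p\<close> takes its place.\<close>

definition bridged_paths :: "nat \<Rightarrow> nat \<times> nat \<Rightarrow> (nat \<times> nat) set" where
  "bridged_paths n p = insert p ((\<lambda>i. (i, Suc i)) ` ({..<n - 1} - {n div 2 - 1}))"

text \<open>For connectedness, everything is reached from 0: walk the first path to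
  \<open>a\<close>, cross to \<open>b\<close>, go back to the start \<open>h\<close> of the second
  path, and from there to any of its points.\<close>

lemma spanning_tree_bridged_paths:
  assumes n: "2 \<le> n" and p: "p \<in> crossing_pairs n"
  shows "spanning_tree {..<n} (bridged_paths n p)"
proof -
  define h where "h = n div 2"
  define T where "T = bridged_paths n p"
  define E where "E = T \<union> T\<inverse>"
  obtain a b where ab: "p = (a, b)" "a < h" "h \<le> b" "b < n"
    using p by (auto simp: crossing_pairs_def h_def)
  have h: "1 \<le> h" "h < n" using n by (auto simp: h_def)
  have mem: "(u, v) \<in> T \<longleftrightarrow> (u, v) = (a, b) \<or> v = Suc u \<and> v < n \<and> v \<noteq> h" for u v
    using h by (auto simp: T_def bridged_paths_def ab h_def[symmetric])
  have "sym (E\<^sup>*)" unfolding E_def by (intro sym_rtrancl sym_Un_converse)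
  then have sy: "(u, v) \<in> E\<^sup>* \<Longrightarrow> (v, u) \<in> E\<^sup>*" for u v by (rule symD)
  have A: "(0, u) \<in> E\<^sup>*" if "u < h" for u
    using that
  proof (induction u)
    case (Suc u)
    then have "(u, Suc u) \<in> E" using h by (auto simp: E_def mem)
    then show ?case using Suc by (meson Suc_lessD rtrancl.simps)
  qed simp
  have B: "h \<le> u \<Longrightarrow> u < n \<Longrightarrow> (h, u) \<in> E\<^sup>*" for u
  proof (induction u rule: dec_induct)
    case (step u)
    then have "(u, Suc u) \<in> E" using h by (auto simp: E_def mem)
    then show ?case using step by (meson Suc_lessD rtrancl.simps)
  qed simp
  have "(a, b) \<in> E" by (simp add: E_def mem)
  then have "(0, h) \<in> E\<^sup>*"
    using A[OF ab(2)] sy[OF B[OF ab(3,4)]] by (meson rtrancl.rtrancl_into_rtrancl rtrancl_trans)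
  then have root: "(0, u) \<in> E\<^sup>*" if "u < n" for u
    using A B that by (meson not_le rtrancl_trans)
  have "connects {..<n} T"
    unfolding connects_def E_def[symmetric] using root sy by (meson lessThan_iff rtrancl_trans)
  moreover have "T \<subseteq> pairs {..<n}"
    using ab by (auto simp: pairs_def mem)
  moreover have "\<not> is_cycle T vs" for vs
  proof -
    text \<open>The rank orders the first path from its left end, followed by the second path
      from the end point of the bridge outwards.\<close>
    define rank where "rank u = (if u < h then u else n + (if u < b then b - u else u - b))" for u
    \<comment> \<open>The offset \<open>n\<close> puts the second path above the first, so the only
      neighbour of \<open>b\<close> not above it is \<open>a\<close>; any other vertex has at most
      its predecessor on its own path.\<close>
    show ?thesis
    proof (rule no_cycle_if_unique_lower_neighbour[where rank = rank])
      fix x y z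
      assume "(y, x) \<in> T \<union> T\<inverse>" "(x, z) \<in> T \<union> T\<inverse>" "rank y \<le> rank x" "rank z \<le> rank x"
      then show "y = z"
        using ab h by (auto simp: mem rank_def split: if_splits)
    qed
  qed
  ultimately show ?thesis unfolding spanning_tree_def T_def by blast
qed

lemma weight_bridged_paths:
  assumes n: "2 \<le> n" and p: "p \<in> crossing_pairs n"
  shows "weight (two_paths n {p}) (bridged_paths n p) = 5 * real n - 3"
proof -
  let ?I = "{..<n - 1} - {n div 2 - 1}"
  let ?f = "\<lambda>i. (i, Suc i)"
  obtain a b where ab: "p = (a, b)" "a < n div 2" "n div 2 \<le> b" "b < n"
    using p by (auto simp: crossing_pairs_def)
  have len: "two_paths n {p} i (Suc i) = 1" if "i \<in> ?I" for i
    using that n by (auto simp: two_paths_def)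
  \<comment> \<open>A consecutive pair joining the two paths could only be
    \<open>(n div 2 - 1, n div 2)\<close>, which is left out; so the bridge is not counted
    twice.\<close>
  have notin: "p \<notin> ?f ` ?I" using ab by auto
  have c: "card ?I = n - 2" using n by (subst card_Diff_singleton) auto
  have "weight (two_paths n {p}) (bridged_paths n p) =
      two_paths n {p} a b + (\<Sum>(u, v)\<in>?f ` ?I. two_paths n {p} u v)"
    unfolding weight_def bridged_paths_def using notin by (simp add: ab(1))
  also have "(\<Sum>(u, v)\<in>?f ` ?I. two_paths n {p} u v) = (\<Sum>i\<in>?I. two_paths n {p} i (Suc i))"
    by (subst sum.reindex) (auto simp: inj_on_def)
  also have "\<dots> = (\<Sum>i\<in>?I. 1)" by (rule sum.cong) (auto simp: len)
  also have "\<dots> = real n - 2" using c n by simp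
  also have "two_paths n {p} a b = 4 * real n - 1" using ab by (simp add: two_paths_def)
  finally show ?thesis by simp
qed

text \<open>Connectedness forces some crossing edge. One other than \<open>p\<close> costs
  \<open>4 * n\<close>, and at least \<open>n - 2\<close> further edges cost at least 1 each: in
  total \<open>5 * n - 2\<close>, one more than the tree bridged at \<open>p\<close>. Thus a correct
  answer reveals \<open>p\<close>.\<close>

lemma minimum_spanning_tree_two_paths:
  assumes n: "2 \<le> n" and p: "p \<in> crossing_pairs n"
    and T: "minimum_spanning_tree {..<n} (two_paths n {p}) T"
  shows "T \<inter> crossing_pairs n = {p}"
proof -
  let ?d = "two_paths n {p}"
  have st: "T \<subseteq> pairs {..<n}" "connects {..<n} T"
    using T by (auto simp: minimum_spanning_tree_def spanning_tree_def)
  have fin: "finite T"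
    by (rule finite_subset[of _ "{..<n} \<times> {..<n}"]) (use st in \<open>auto simp: pairs_def\<close>)
  have "n \<le> Suc (card T)"
    using card_edges_if_connects[of "{..<n}" 0 T] st n by simp
  have "weight ?d T \<le> weight ?d (bridged_paths n p)"
    using T spanning_tree_bridged_paths[OF n p] by (auto simp: minimum_spanning_tree_def)
  then have w: "weight ?d T \<le> 5 * real n - 3" by (simp add: weight_bridged_paths[OF n p])
  have "e = p" if e: "e \<in> T \<inter> crossing_pairs n" for e
  proof (rule ccontr)
    assume "e \<noteq> p"
    then have de: "(case e of (u, v) \<Rightarrow> ?d u v) = 4 * real n"
      using e p by (cases e; cases p) (auto simp: two_paths_def crossing_pairs_def)
    have "real (card (T - {e})) = (\<Sum>e\<in>T - {e}. 1)" by simp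
    also have "\<dots> \<le> (\<Sum>(u, v)\<in>T - {e}. ?d u v)"
      using st n by (intro sum_mono) (auto simp: pairs_def two_paths_def)
    finally have "4 * real n + real (card (T - {e})) \<le> weight ?d T"
      unfolding weight_def using sum.remove[of T e "\<lambda>(u, v). ?d u v"] fin e de by simp
    moreover have "card T = Suc (card (T - {e}))"
      using e fin by (metis Int_iff card_Suc_Diff1)
    ultimately show False using w \<open>n \<le> Suc (card T)\<close> by simp
  qed
  moreover have "T \<inter> crossing_pairs n \<noteq> {}"
  proof -
    have "\<exists>(u, v)\<in>T. (u < n div 2) \<noteq> (v < n div 2)"
      using n by (intro connects_crosses_cut[OF st(2), of 0 "n - 1"]) auto
    then obtain u v where uv: "(u, v) \<in> T" "(u < n div 2) \<noteq> (v < n div 2)" by blast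
    moreover have "u < v" "v < n" using uv st by (auto simp: pairs_def)
    ultimately have "(u, v) \<in> crossing_pairs n" by (auto simp: crossing_pairs_def)
    then show ?thesis using uv by blast
  qed
  ultimately show ?thesis by blast
qed

section \<open>Runs of a program\<close>

text \<open>Only configurations before halting contribute, as in \<open>num_queries\<close>.\<close>

definition queried :: "'c program \<Rightarrow> nat \<Rightarrow> (nat \<Rightarrow> nat \<Rightarrow> real) \<Rightarrow> (nat \<times> nat) set" where
  "queried P m d = (\<Union>t\<in>{t. \<not> halted P m d t}. \<Union>i<m. queries P (config P m d t i))"

text \<open>Until halting, both runs receive the same answers and so pass through the same
  configurations; hence they halt together with the same result.\<close>

lemma outcome_cong:
  assumes agree: "\<And>u v. (u, v) \<in> queried P m d \<Longrightarrow> d u v = d' u v"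
  shows "outcome P m d = outcome P m d'"
proof -
  \<comment> \<open>Only strictly earlier configurations are required not to halt, so the equality
    still covers the halting configuration from which the result is read.\<close>
  have conf: "\<forall>t'<t. \<not> halted P m d t' \<Longrightarrow> config P m d' t = config P m d t" for t
  proof (induction t)
    case (Suc t)
    then have eq: "config P m d' t = config P m d t" and "\<not> halted P m d t" by auto
    then have "answers P m d' (config P m d t) = answers P m d (config P m d t)"
      using agree by (fastforce simp: answers_def queried_def fun_eq_iff)
    then show ?case by (simp add: eq)
  qed simp
  have halt: "halted P m d t \<longleftrightarrow> halted P m d' t" for t
  proof (induction t rule: less_induct)
    case (less t)
    show ?case
    proof (cases "\<exists>t'<t. halted P m d t'")
      case True
      then show ?thesis using less by (meson halted_def le_trans less_imp_le)
    next
      case False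
      then have "\<forall>t'\<le>t. config P m d' t' = config P m d t'" using conf by auto
      then show ?thesis unfolding halted_def by metis
    qed
  qed
  show ?thesis
  proof (cases "\<exists>t. halted P m d t")
    case True
    have "config P m d' (LEAST t. halted P m d t) = config P m d (LEAST t. halted P m d t)"
      by (intro conf allI impI not_less_Least)
    then show ?thesis unfolding outcome_def halt by simp
  qed (simp add: outcome_def halt)
qed

lemma black_box_program_queries:
  assumes "black_box_program n s P"
  shows "queries P c \<subseteq> pairs {..<n}" "finite (queries P c)" "card (queries P c) \<le> s\<^sup>2"
proof -
  have held: "held P c \<subseteq> {..<n}" "card (held P c) \<le> s" "queries P c \<subseteq> pairs (held P c)"
    using assms by (auto simp: black_box_program_def)
  then show "queries P c \<subseteq> pairs {..<n}" by (auto simp: pairs_def)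
  have fin: "finite (held P c)" using held(1) finite_subset by blast
  have sub: "queries P c \<subseteq> held P c \<times> held P c" using held(3) by (auto simp: pairs_def)
  then show "finite (queries P c)" using fin finite_subset by blast
  have "card (queries P c) \<le> card (held P c \<times> held P c)"
    using sub fin by (intro card_mono) auto
  also have "\<dots> \<le> s\<^sup>2" using held(2) by (simp add: card_cartesian_product power2_eq_square mult_le_mono)
  finally show "card (queries P c) \<le> s\<^sup>2" .
qed

lemma finite_queried:
  assumes "black_box_program n s P"
  shows "finite (queried P m d)"
proof (rule finite_subset)
  show "queried P m d \<subseteq> {..<n} \<times> {..<n}"
    using black_box_program_queries(1)[OF assms] by (fastforce simp: queried_def pairs_def)
qed simp

text \<open>The cost counts a pair once per machine and round that queries it, so it can only exceed
  the number of distinct pairs.\<close>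

lemma card_queried_le_num_queries:
  assumes "black_box_program n s P"
  shows "of_nat (card (queried P m d)) \<le> num_queries P m d"
proof -
  define q where "q t = (if halted P m d t then 0 else \<Sum>i<m. card (queries P (config P m d t i)))" for t
  define Q where "Q t = (if halted P m d t then {} else \<Union>i<m. queries P (config P m d t i))" for t
  have Qf: "finite (Q t)" for t
    using black_box_program_queries(2)[OF assms] by (auto simp: Q_def)
  have Qq: "card (Q t) \<le> q t" for t
    by (auto simp: Q_def q_def intro: card_UN_le)
  have "queried P m d \<subseteq> (\<Union>t. Q t)" by (auto simp: queried_def Q_def)
  \<comment> \<open>Finitely many rounds already account for the finite set of queried pairs, even
    if the run never halts; the series is then bounded below by a finite partial sum.\<close>
  then obtain F where F: "finite F" "queried P m d \<subseteq> (\<Union>t\<in>F. Q t)"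
    using finite_queried[OF assms] by (metis finite_subset_Union finite_subset_image)
  have "card (queried P m d) \<le> card (\<Union>t\<in>F. Q t)"
    using F Qf by (intro card_mono) auto
  also have "\<dots> \<le> (\<Sum>t\<in>F. card (Q t))" using F by (intro card_UN_le)
  also have "\<dots> \<le> (\<Sum>t\<in>F. q t)" by (intro sum_mono Qq)
  finally have "(of_nat (card (queried P m d)) :: ennreal) \<le> of_nat (\<Sum>t\<in>F. q t)"
    by (simp only: of_nat_le_iff)
  also have "\<dots> = (\<Sum>t\<in>F. of_nat (q t))" by simp
  also have "\<dots> \<le> (\<Sum>t. of_nat (q t))" using F(1) by (intro sum_le_suminf) auto
  also have "\<dots> = num_queries P m d"
    unfolding num_queries_def q_def by (intro suminf_cong) simp
  finally show ?thesis .
qed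

lemma num_queries_le_num_rounds:
  assumes "black_box_program n s P"
  shows "num_queries P m d \<le> of_nat (m * s\<^sup>2) * num_rounds P m d"
proof -
  have "(\<Sum>i<m. card (queries P (config P m d t i))) \<le> m * s\<^sup>2" for t
    using sum_bounded_above[of "{..<m}" "\<lambda>i. card (queries P (config P m d t i))" "s\<^sup>2"]
      black_box_program_queries(3)[OF assms] by simp
  then have le: "(of_nat (\<Sum>i<m. card (queries P (config P m d t i))) :: ennreal) \<le> of_nat (m * s\<^sup>2)" for t
    by (simp only: of_nat_le_iff)
  have "num_queries P m d \<le> (\<Sum>t. of_nat (m * s\<^sup>2) * (if halted P m d t then 0 else 1))"
    unfolding num_queries_def using le by (intro suminf_le) auto
  also have "\<dots> = of_nat (m * s\<^sup>2) * num_rounds P m d"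
    unfolding num_rounds_def by (rule ennreal_suminf_cmult)
  finally show ?thesis .
qed

section \<open>The lower bound\<close>

text \<open>For all unqueried pairs the run equals the unperturbed one, so the same tree is
  returned. Its crossing edge would have to be each correctly solved pair at once, which leaves at
  most one such pair.\<close>

lemma card_correct_le_card_queried:
  assumes n: "2 \<le> n" and P: "black_box_program n s P"
  shows "card {p \<in> crossing_pairs n. \<exists>T. outcome P m (two_paths n {p}) = Some T \<and>
             minimum_spanning_tree {..<n} (two_paths n {p}) T}
         \<le> Suc (card (queried P m (two_paths n {})))"
    (is "card ?G \<le> Suc (card ?Q)")
proof -
  define R where "R = ?G - ?Q"
  have same: "outcome P m (two_paths n {p}) = outcome P m (two_paths n {})"
    if "p \<in> crossing_pairs n" "p \<notin> ?Q" for p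
  proof (rule outcome_cong[symmetric])
    \<comment> \<open>Queries are increasing pairs, so the reversed query \<open>(v, u)\<close>
      cannot be the shortened pair either.\<close>
    fix u v assume uv: "(u, v) \<in> ?Q"
    then have "u < v"
      using black_box_program_queries(1)[OF P] by (fastforce simp: queried_def pairs_def)
    then show "two_paths n {} u v = two_paths n {p} u v"
      using uv that by (auto simp: two_paths_def crossing_pairs_def)
  qed
  have "p = q" if pq: "p \<in> R" "q \<in> R" for p q
  proof -
    have p: "p \<in> crossing_pairs n" "p \<notin> ?Q" and q: "q \<in> crossing_pairs n" "q \<notin> ?Q"
      using pq by (simp_all add: R_def)
    obtain T where T: "outcome P m (two_paths n {}) = Some T"
      "minimum_spanning_tree {..<n} (two_paths n {p}) T"
      using pq(1) same[OF p] by (auto simp: R_def)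
    then have "minimum_spanning_tree {..<n} (two_paths n {q}) T"
      using pq(2) same[OF q] by (simp add: R_def)
    then have "{p} = {q}"
      using minimum_spanning_tree_two_paths[OF n] T(2) p q by metis
    then show "p = q" by simp
  qed
  moreover have fin: "finite R" by (simp add: R_def crossing_pairs_def)
  ultimately have "card R \<le> Suc 0" by (simp add: card_le_Suc0_iff_eq)
  moreover have "card ?G \<le> card (R \<union> ?Q)"
    using fin finite_queried[OF P] by (intro card_mono) (auto simp: R_def)
  ultimately show ?thesis using card_Un_le[of R ?Q] by linarith
qed

text \<open>Linearity of expectation is applied to the integrable minorant \<open>g\<close>, built
  from indicators of events; \<open>F\<close> may be non-measurable and enters only through
  monotonicity of \<open>nn_integral\<close>. The factor \<open>c\<close> lets one statement serve
  queries and rounds.\<close>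

lemma (in prob_space) nn_integral_ge_of_events:
  fixes F :: "'a \<Rightarrow> ennreal" and c :: real
  assumes I: "finite I" and meas: "\<And>i. i \<in> I \<Longrightarrow> S i \<in> events"
    and prob: "\<And>i. i \<in> I \<Longrightarrow> 1 / 2 \<le> prob (S i)" and c: "0 < c"
    and le: "\<And>\<omega>. \<omega> \<in> space M \<Longrightarrow>
               ennreal (real (card {i \<in> I. \<omega> \<in> S i}) - 1) \<le> ennreal c * F \<omega>"
  shows "ennreal ((real (card I) / 2 - 1) / c) \<le> (\<integral>\<^sup>+\<omega>. F \<omega> \<partial>M)"
proof -
  define g where "g \<omega> = ((\<Sum>i\<in>I. indicator (S i) \<omega>) - 1) / c" for \<omega>
  have int: "integrable M g"
    unfolding g_def using meas by (auto simp: emeasure_eq_measure)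
  have "(real (card I) / 2 - 1) / c \<le> ((\<Sum>i\<in>I. prob (S i)) - 1) / c"
    using sum_mono[of I "\<lambda>_. 1 / 2" "\<lambda>i. prob (S i)"] prob c by (intro divide_right_mono) auto
  also have "\<dots> = (\<integral>\<omega>. g \<omega> \<partial>M)"
    unfolding g_def using meas by (simp add: emeasure_eq_measure prob_space)
  \<comment> \<open>\<open>g\<close> is negative where none of the events occurs; truncation at 0
    prepares the passage to the nonnegative integral.\<close>
  also have "\<dots> \<le> (\<integral>\<omega>. max 0 (g \<omega>) \<partial>M)"
    using int by (intro integral_mono) auto
  finally have "ennreal ((real (card I) / 2 - 1) / c) \<le> ennreal (\<integral>\<omega>. max 0 (g \<omega>) \<partial>M)"
    by (rule ennreal_leI)
  also have "\<dots> = (\<integral>\<^sup>+\<omega>. ennreal (max 0 (g \<omega>)) \<partial>M)"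
    using int by (intro nn_integral_eq_integral[symmetric]) auto
  also have "\<dots> \<le> (\<integral>\<^sup>+\<omega>. F \<omega> \<partial>M)"
  proof (rule nn_integral_mono)
    fix \<omega> assume \<omega>: "\<omega> \<in> space M"
    have "(\<Sum>i\<in>I. indicator (S i) \<omega>) = real (card {i \<in> I. \<omega> \<in> S i})"
      using I by (simp add: indicator_def sum.If_cases Int_def)
    then have "ennreal (g \<omega>) = ennreal (1 / c) * ennreal (real (card {i \<in> I. \<omega> \<in> S i}) - 1)"
      using c by (subst ennreal_mult'[symmetric]) (auto simp: g_def)
    also have "\<dots> \<le> ennreal (1 / c) * (ennreal c * F \<omega>)"
      by (intro mult_left_mono le \<omega>) simp
    also have "\<dots> = F \<omega>"
      using c by (simp add: mult.assoc[symmetric] ennreal_mult'[symmetric])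
    finally show "ennreal (max 0 (g \<omega>)) \<le> F \<omega>" by (simp add: max_def ennreal_neg)
  qed
  finally show ?thesis .
qed

text \<open>There are \<open>h * (n - h)\<close> crossing pairs with \<open>h = n div 2\<close>, and
  the claim amounts to \<open>n^2 + 16 \<le> 8 * h * (n - h)\<close>, checked for even and odd
  \<open>n\<close>. The 1 subtracted pays for the one pair that may be solved without a
  query.\<close>

lemma card_crossing_pairs:
  assumes "6 < n"
  shows "real n ^ 2 / 16 \<le> real (card (crossing_pairs n)) / 2 - 1"
proof -
  define h where "h = n div 2"
  have h: "3 \<le> h" "n = 2 * h \<or> n = 2 * h + 1" using assms by (auto simp: h_def)
  have "card (crossing_pairs n) = h * (n - h)"
    by (simp add: crossing_pairs_def h_def card_cartesian_product)
  moreover have "n\<^sup>2 + 16 \<le> 8 * (h * (n - h))"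
  proof -
    have "3 * h \<le> h * h" using h by simp
    then have "9 \<le> h * h" using h(1) by linarith
    then show ?thesis using h by (auto simp: power2_eq_square algebra_simps)
  qed
  ultimately have "real (n\<^sup>2 + 16) \<le> real (8 * card (crossing_pairs n))" by (simp only: of_nat_le_iff)
  then show ?thesis by simp
qed

theorem theorem7p4:
  fixes n m s :: nat and M :: "'w measure" and A :: "'w \<Rightarrow> 'c program"
  assumes "n > 6" and "m \<ge> 1" and "s \<ge> 2"
    and "prob_space M"
    and "\<And>\<omega>. \<omega> \<in> space M \<Longrightarrow> black_box_program n s (A \<omega>)"
    and "\<And>d. low_doubling_input n d \<Longrightarrow> success_probability M A n m d > 1 / 2"
  shows "\<exists>d. low_doubling_input n d \<and>
           expected_queries M A m d \<ge> ennreal (real n ^ 2 / 16) \<and>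
           expected_rounds M A m d \<ge> ennreal (real n ^ 2 / (16 * real m * real s ^ 2))"
proof -
  interpret prob_space M by fact
  \<comment> \<open>The unperturbed metric is the hard input for both costs, while success is
    invoked on the metrics shortened at a single pair.\<close>
  let ?d = "two_paths n {}"
  define S where "S p = {\<omega> \<in> space M. \<exists>T. outcome (A \<omega>) m (two_paths n {p}) = Some T \<and>
                           minimum_spanning_tree {..<n} (two_paths n {p}) T}" for p
  have n: "2 \<le> n" using assms(1) by simp
  have fin: "finite (crossing_pairs n)" by (simp add: crossing_pairs_def)
  have prob: "prob (S p) > 1 / 2" for p
    using assms(6)[OF low_doubling_input_two_paths[OF n, of "{p}"]]
    by (simp add: success_probability_def S_def)
  \<comment> \<open>A set that is not an event has \<open>measure\<close> 0, so the success
    probability forces measurability.\<close>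
  have meas: "S p \<in> events" for p
    using prob[of p] measure_notin_sets[of "S p" M] by force
  have q: "ennreal (real (card {p \<in> crossing_pairs n. \<omega> \<in> S p}) - 1) \<le> num_queries (A \<omega>) m ?d"
    if \<omega>: "\<omega> \<in> space M" for \<omega>
  proof -
    have "card {p \<in> crossing_pairs n. \<omega> \<in> S p} \<le> Suc (card (queried (A \<omega>) m ?d))"
      using card_correct_le_card_queried[OF n assms(5)[OF \<omega>], of m] \<omega> by (simp add: S_def)
    then have "ennreal (real (card {p \<in> crossing_pairs n. \<omega> \<in> S p}) - 1)
               \<le> ennreal (real (card (queried (A \<omega>) m ?d)))"
      by (intro ennreal_leI) linarith
    also have "\<dots> \<le> num_queries (A \<omega>) m ?d"
      using card_queried_le_num_queries[OF assms(5)[OF \<omega>]] by (simp add: ennreal_of_nat_eq_real_of_nat)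
    finally show ?thesis .
  qed
  \<comment> \<open>To be used with \<open>c = 1\<close> for queries and \<open>c = m * s^2\<close>,
    the most queries a round can make, for rounds.\<close>
  have bound: "ennreal (real n ^ 2 / 16 / c) \<le> (\<integral>\<^sup>+\<omega>. F \<omega> \<partial>M)"
    if "0 < c" "\<And>\<omega>. \<omega> \<in> space M \<Longrightarrow> num_queries (A \<omega>) m ?d \<le> ennreal c * F \<omega>" for c F
  proof -
    have "ennreal (real n ^ 2 / 16 / c) \<le> ennreal ((real (card (crossing_pairs n)) / 2 - 1) / c)"
      using card_crossing_pairs[OF assms(1)] that(1) by (intro ennreal_leI divide_right_mono) auto
    also have "\<dots> \<le> (\<integral>\<^sup>+\<omega>. F \<omega> \<partial>M)"
      using q that by (intro nn_integral_ge_of_events[where S = S] fin meas less_imp_le[OF prob])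
        (blast intro: order_trans)+
    finally show ?thesis .
  qed
  have "ennreal (real n ^ 2 / 16) \<le> expected_queries M A m ?d"
    unfolding expected_queries_def using bound[of 1 "\<lambda>\<omega>. num_queries (A \<omega>) m ?d"] by simp
  moreover have "ennreal (real n ^ 2 / (16 * real m * real s ^ 2)) \<le> expected_rounds M A m ?d"
  proof -
    have "num_queries (A \<omega>) m ?d \<le> ennreal (real (m * s\<^sup>2)) * num_rounds (A \<omega>) m ?d"
      if "\<omega> \<in> space M" for \<omega>
      using num_queries_le_num_rounds[OF assms(5)[OF that]]
      by (simp only: ennreal_of_nat_eq_real_of_nat)
    moreover have "0 < real (m * s\<^sup>2)" using assms(2,3) by simp
    ultimately show ?thesis
      unfolding expected_rounds_def
      using bound[of "real (m * s\<^sup>2)" "\<lambda>\<omega>. num_rounds (A \<omega>) m ?d"] by (simp add: mult.assoc)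
  qed
  ultimately show ?thesis using low_doubling_input_two_paths[OF n] by blast
qed

end
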